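(* Let $n,m\ge 1$ be integers and let $\mathbf{x}\in\mathbb{R}^n$. Consider the minimization problem, over all random vectors $\Phi(\mathbf{x})$ in $\mathbb{R}^n$, $$\min_{\Phi(\mathbf{x})}\Bigl\{\mathrm{E}\lVert\mathbf{x}-\Phi(\mathbf{x})\rVert_2^2\ :\ \lVert\Phi(\mathbf{x})\rVert_0\le m,\ \ \mathrm{E}\,\Phi(\mathbf{x})=\mathbf{x}\Bigr\},$$ where the sparsity constraint is required almost surely. Let $\alpha$ be a permutation of $\{1,\dots,n\}$ with $|\mathbf{x}_{\alpha(1)}|\ge|\mathbf{x}_{\alpha(2)}|\ge\cdots\ge|\mathbf{x}_{\alpha(n)}|$. Then the minimum is attained, and a random vector $\Phi(\mathbf{x})$ satisfying the two constraints is a minimizer if and only if it has the following three properties, for an integer $k$ with $0\le k\le n$: 1. The $k$ largest-magnitude entries $\mathbf{x}_{\alpha(1)},\dots,\mathbf{x}_{\alpha(k)}$ are preserved exactly: $\Phi(\mathbf{x})_{\alpha(i)}=\mathbf{x}_{\alpha(i)}$ almost surely for $1\le i\le k$. 2. The remaining entries $\mathbf{x}_{\alpha(k+1)},\dots,\mathbf{x}_{\alpha(n)}$ are randomly perturbed: for $k+1\le i\le n$, $\Phi(\mathbf{x})_{\alpha(i)}=\mathbf{x}_{\alpha(i)}/\mathbf{p}_{\alpha(i)}$ with probability $\mathbf{p}_{\alpha(i)}$ and $\Phi(\mathbf{x})_{\alpha(i)}=0$ otherwise, where $$\mathbf{p}_{\alpha(i)}=\frac{(m-k)\,|\mathbf{x}_{\alpha(i)}|}{\sum_{l=k+1}^n|\mathbf{x}_{\alpha(l)}|}.$$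 3. The number $k$ is as small as possible while ensuring $\mathbf{p}_{\alpha(i)}\le 1$ for all $i\ge k+1$.
   Context: For a vector $\mathbf{y}\in\mathbb{R}^n$, $\lVert\mathbf{y}\rVert_2$ is the Euclidean norm and $\lVert\mathbf{y}\rVert_0$ is the number of nonzero entries of $\mathbf{y}$. Conventions: if $\mathbf{x}_{\alpha(i)}=0$ for some $i\ge k+1$, then $\mathbf{p}_{\alpha(i)}=0$ (also when the denominator vanishes) and property 2 means $\Phi(\mathbf{x})_{\alpha(i)}=0$ almost surely. Properties 1 and 2 constrain only the marginal distributions of the entries of $\Phi(\mathbf{x})$. *)

theory Defs
  imports "HOL-Probability.Probability"
begin

definition l0_norm :: "real ^ 'n::finite \<Rightarrow> nat" where
  "l0_norm y = card {i. y $ i \<noteq> 0}"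

definition feasible :: "real ^ 'n::finite \<Rightarrow> nat \<Rightarrow> 'w measure \<Rightarrow> ('w \<Rightarrow> real ^ 'n) \<Rightarrow> bool" where
  "feasible x m M \<Phi> \<longleftrightarrow>
     prob_space M \<and> \<Phi> \<in> borel_measurable M \<and>
     (AE \<omega> in M. l0_norm (\<Phi> \<omega>) \<le> m) \<and>
     integrable M \<Phi> \<and> integral\<^sup>L M \<Phi> = x"

text \<open>The expected squared error is a nonnegative integral with values in \<^typ>\<open>ennreal\<close>:
  a feasible \<open>\<Phi>\<close> need not be square integrable, and its objective value is then infinite
  (a Bochner integral would return 0).\<close>

definition objective :: "real ^ 'n::finite \<Rightarrow> 'w measure \<Rightarrow> ('w \<Rightarrow> real ^ 'n) \<Rightarrow> ennreal" where
  "objective x M \<Phi> = (\<integral>\<^sup>+ \<omega>. ennreal ((norm (x - \<Phi> \<omega>))\<^sup>2) \<partial>M)"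

text \<open>A formula of HOL cannot quantify over the type underlying a probability space. The
  competitors below live on all probability spaces over \<^typ>\<open>real ^ 'n\<close>; every law of a random
  vector is realized there (by the identity map), so this is minimality among random vectors on
  arbitrary probability spaces. See the lemma \<open>is_minimizer_le\<close>.\<close>

definition is_minimizer :: "real ^ 'n::finite \<Rightarrow> nat \<Rightarrow> 'w measure \<Rightarrow> ('w \<Rightarrow> real ^ 'n) \<Rightarrow> bool" where
  "is_minimizer x m M \<Phi> \<longleftrightarrow>
     feasible x m M \<Phi> \<and>
     (\<forall>(N :: (real ^ 'n) measure) (\<Psi> :: real ^ 'n \<Rightarrow> real ^ 'n).
        feasible x m N \<Psi> \<longrightarrow> objective x M \<Phi> \<le> objective x N \<Psi>)"

lemma measurable_l0_norm [measurable]: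
  "(l0_norm :: real ^ 'n::finite \<Rightarrow> nat) \<in> borel \<rightarrow>\<^sub>M count_space UNIV"
proof -
  have [measurable]: "(\<lambda>y :: real ^ 'n. y $ i) \<in> borel_measurable borel" for i
    by (intro borel_measurable_continuous_onI continuous_intros)
  have eq: "l0_norm = (\<lambda>y :: real ^ 'n. \<Sum>i\<in>UNIV. if y $ i \<noteq> 0 then 1 else (0::nat))"
    unfolding l0_norm_def fun_eq_iff by (subst sum.If_cases) auto
  show ?thesis unfolding eq by measurable
qed

lemma feasible_distr:
  assumes "feasible x m N \<Psi>"
  shows "feasible x m (distr N borel \<Psi>) (\<lambda>y. y)"
    and "objective x (distr N borel \<Psi>) (\<lambda>y. y) = objective x N \<Psi>"
proof -
  have [measurable]: "\<Psi> \<in> borel_measurable N"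
    using assms by (simp add: feasible_def)
  show "feasible x m (distr N borel \<Psi>) (\<lambda>y. y)"
    using assms
    by (simp add: feasible_def prob_space.prob_space_distr AE_distr_iff integrable_distr_eq
        integral_distr)
  show "objective x (distr N borel \<Psi>) (\<lambda>y. y) = objective x N \<Psi>"
    by (simp add: objective_def nn_integral_distr)
qed

lemma is_minimizer_le:
  assumes "is_minimizer x m M \<Phi>" and "feasible x m N \<Psi>"
  shows "objective x M \<Phi> \<le> objective x N \<Psi>"
  using assms(1) feasible_distr[OF assms(2)] unfolding is_minimizer_def by metis

text \<open>\<open>\<alpha> :: nat \<Rightarrow> 'n\<close> enumerates the \<open>n = CARD('n)\<close> coordinates as \<open>\<alpha> 1, \<dots>, \<alpha> n\<close>, and
  \<open>keep_prob x m \<alpha> k i\<close> is the probability attached to coordinate \<open>\<alpha> i\<close>. The difference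
  \<open>m - k\<close> is taken in the reals. If \<open>x $ \<alpha> i = 0\<close> the numerator is 0, so the value is 0 also when
  the denominator vanishes.\<close>

definition keep_prob :: "real ^ 'n::finite \<Rightarrow> nat \<Rightarrow> (nat \<Rightarrow> 'n) \<Rightarrow> nat \<Rightarrow> nat \<Rightarrow> real" where
  "keep_prob x m \<alpha> k i =
     (real m - real k) * \<bar>x $ \<alpha> i\<bar> / (\<Sum>l = k+1..CARD('n). \<bar>x $ \<alpha> l\<bar>)"

definition preserves_largest ::
    "real ^ 'n::finite \<Rightarrow> (nat \<Rightarrow> 'n) \<Rightarrow> nat \<Rightarrow> 'w measure \<Rightarrow> ('w \<Rightarrow> real ^ 'n) \<Rightarrow> bool" where
  "preserves_largest x \<alpha> k M \<Phi> \<longleftrightarrow>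
     (\<forall>i\<in>{1..k}. AE \<omega> in M. \<Phi> \<omega> $ \<alpha> i = x $ \<alpha> i)"

definition perturbs_rest ::
    "real ^ 'n::finite \<Rightarrow> nat \<Rightarrow> (nat \<Rightarrow> 'n) \<Rightarrow> nat \<Rightarrow> 'w measure \<Rightarrow> ('w \<Rightarrow> real ^ 'n) \<Rightarrow> bool" where
  "perturbs_rest x m \<alpha> k M \<Phi> \<longleftrightarrow>
     (\<forall>i\<in>{k+1..CARD('n)}.
        let p = keep_prob x m \<alpha> k i in
        if x $ \<alpha> i = 0 then AE \<omega> in M. \<Phi> \<omega> $ \<alpha> i = 0
        else measure M {\<omega> \<in> space M. \<Phi> \<omega> $ \<alpha> i = x $ \<alpha> i / p} = p \<and>
             (AE \<omega> in M. \<Phi> \<omega> $ \<alpha> i = x $ \<alpha> i / p \<or> \<Phi> \<omega> $ \<alpha> i = 0))"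

definition probs_le_1 :: "real ^ 'n::finite \<Rightarrow> nat \<Rightarrow> (nat \<Rightarrow> 'n) \<Rightarrow> nat \<Rightarrow> bool" where
  "probs_le_1 x m \<alpha> k \<longleftrightarrow> (\<forall>i\<in>{k+1..CARD('n)}. keep_prob x m \<alpha> k i \<le> 1)"

definition k_smallest :: "real ^ 'n::finite \<Rightarrow> nat \<Rightarrow> (nat \<Rightarrow> 'n) \<Rightarrow> nat \<Rightarrow> bool" where
  "k_smallest x m \<alpha> k \<longleftrightarrow> probs_le_1 x m \<alpha> k \<and> (\<forall>j<k. \<not> probs_le_1 x m \<alpha> j)"

end

theory Submission imports Defs begin

text \<open>Lagrangian duality for the constraint \<open>E \<parallel>\<Phi>\<parallel>\<^sub>0 \<le> m\<close> with multiplier \<open>\<tau>\<^sup>2\<close>. Each coordinate satisfies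
  a pointwise inequality \<open>(a - y)\<^sup>2 + \<tau>\<^sup>2 [y \<noteq> 0] \<ge> tangent \<tau> a y\<close> whose right-hand side is affine
  in \<open>y\<close>, so that its expectation depends only on \<open>E \<Phi> = x\<close>. Summing over the coordinates bounds the
  objective below, and equality holds iff almost surely every coordinate is a contact point of its
  tangent: \<open>x\<^sub>i\<close> if \<open>\<bar>x\<^sub>i\<bar> > \<tau>\<close>, and one of \<open>0\<close>, \<open>\<tau> sgn x\<^sub>i\<close> otherwise. With
  \<open>\<tau> = (\<Sum>\<^bsub>l>k\<^esub> \<bar>x\<^bsub>\<alpha>(l)\<^esub>\<bar>) / (m - k)\<close> for the smallest admissible \<open>k\<close> the entries above \<open>\<tau>\<close> are the \<open>k\<close>
  largest and \<open>\<tau> sgn x\<^sub>i = x\<^sub>i / p\<^sub>i\<close>; systematic sampling realizes the required marginals with at most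
  \<open>m\<close> nonzero entries.\<close>

section \<open>Contact points and supporting lines for one coordinate\<close>

text \<open>For \<open>\<tau> = 0\<close> the division by zero concerns only \<open>a = 0\<close> and gives the intended value 0. That case
  arises exactly when only the \<open>k < m\<close> preserved entries are nonzero, which is why complementary
  slackness in \<open>is_threshold\<close> carries the factor \<open>\<tau>\<close>.\<close>

definition incl_prob :: "real \<Rightarrow> real \<Rightarrow> real" where
  "incl_prob \<tau> a = (if \<bar>a\<bar> > \<tau> then 1 else \<bar>a\<bar> / \<tau>)"

definition opt_vals :: "real \<Rightarrow> real \<Rightarrow> real set" where
  "opt_vals \<tau> a = (if \<bar>a\<bar> > \<tau> then {a} else {0, \<tau> * sgn a})"

definition is_threshold :: "real ^ 'n::finite \<Rightarrow> nat \<Rightarrow> real \<Rightarrow> bool" where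
  "is_threshold x m \<tau> \<longleftrightarrow> 0 \<le> \<tau> \<and> (\<Sum>i\<in>UNIV. incl_prob \<tau> (x $ i)) \<le> real m \<and>
     \<tau> * (\<Sum>i\<in>UNIV. incl_prob \<tau> (x $ i)) = \<tau> * real m"

text \<open>For \<open>\<bar>a\<bar> > \<tau>\<close> the constant is the minimum over
  \<open>y\<close> of the penalized error, reached at \<open>y = a\<close>. Otherwise, for
  \<open>a \<noteq> 0\<close>, it is the line through the isolated point at \<open>y = 0\<close> of
  height \<open>a\<^sup>2\<close> that touches the parabola at
  \<open>\<tau> * sgn a\<close>.\<close>

definition tangent :: "real \<Rightarrow> real \<Rightarrow> real \<Rightarrow> real" where
  "tangent \<tau> a y = (if \<bar>a\<bar> > \<tau> then \<tau>\<^sup>2 else 2 * (\<tau> * sgn a - a) * y + a\<^sup>2)"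

text \<open>Each summand is the variance of a variable with mean \<open>x $ i\<close> and values in
  \<open>opt_vals \<tau> (x $ i)\<close>; it is 0 for a preserved entry.\<close>

definition opt_value :: "real \<Rightarrow> real ^ 'n::finite \<Rightarrow> real" where
  "opt_value \<tau> x = (\<Sum>i\<in>UNIV. \<bar>x $ i\<bar> * max 0 (\<tau> - \<bar>x $ i\<bar>))"

lemma opt_value_nonneg: "0 \<le> opt_value \<tau> x"
  unfolding opt_value_def by (intro sum_nonneg mult_nonneg_nonneg) auto

lemma
  assumes "0 \<le> \<tau>"
  shows tangent_le: "tangent \<tau> a y \<le> (a - y)\<^sup>2 + \<tau>\<^sup>2 * of_bool (y \<noteq> 0)"
    and tangent_eqD: "(a - y)\<^sup>2 + \<tau>\<^sup>2 * of_bool (y \<noteq> 0) \<le> tangent \<tau> a y \<Longrightarrow> y \<in> opt_vals \<tau> a"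
proof -
  have "tangent \<tau> a y \<le> (a - y)\<^sup>2 + \<tau>\<^sup>2 * of_bool (y \<noteq> 0) \<and>
     ((a - y)\<^sup>2 + \<tau>\<^sup>2 * of_bool (y \<noteq> 0) \<le> tangent \<tau> a y \<longrightarrow> y \<in> opt_vals \<tau> a)"
  proof (cases "\<bar>a\<bar> > \<tau>")
    case True
    \<comment> \<open>This rules out \<open>y = 0\<close>, whose cost is
      \<open>a\<^sup>2\<close>.\<close>
    then have "\<tau>\<^sup>2 < a\<^sup>2"
      using assms by (metis abs_of_nonneg abs_ge_zero power2_abs power_strict_mono zero_less_numeral)
    with True show ?thesis
      by (auto simp: tangent_def opt_vals_def)
  next
    case False
    show ?thesis
    proof (cases "y = 0")
      case True
      with False show ?thesis by (auto simp: tangent_def opt_vals_def)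
    next
      case nz: False
      \<comment> \<open>Off zero the gap is a square plus a nonnegative term that can survive only
        for \<open>a = 0\<close>, so a vanishing gap forces
        \<open>y = \<tau> * sgn a\<close>.\<close>
      have eq: "(a - y)\<^sup>2 + \<tau>\<^sup>2 * of_bool (y \<noteq> 0) - tangent \<tau> a y
          = (y - \<tau> * sgn a)\<^sup>2 + \<tau>\<^sup>2 * (1 - (sgn a)\<^sup>2)"
        using False nz by (simp add: tangent_def power2_eq_square algebra_simps)
      have nn: "0 \<le> \<tau>\<^sup>2 * (1 - (sgn a)\<^sup>2)"
        by (auto simp: sgn_if)
      have "(y - \<tau> * sgn a)\<^sup>2 \<le> 0 \<Longrightarrow> y \<in> opt_vals \<tau> a"
        using False by (simp add: opt_vals_def)
      with eq nn show ?thesis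
        by (smt (verit) zero_le_power2)
    qed
  qed
  then show "tangent \<tau> a y \<le> (a - y)\<^sup>2 + \<tau>\<^sup>2 * of_bool (y \<noteq> 0)"
    and "(a - y)\<^sup>2 + \<tau>\<^sup>2 * of_bool (y \<noteq> 0) \<le> tangent \<tau> a y \<Longrightarrow> y \<in> opt_vals \<tau> a"
    by blast+
qed

section \<open>Weak duality and its equality case\<close>

lemma power2_norm_diff_vec: "(norm (x - y :: real ^ 'n::finite))\<^sup>2 = (\<Sum>i\<in>UNIV. (x $ i - y $ i)\<^sup>2)"
  by (simp add: norm_vec_def L2_set_def sum_nonneg)

lemma l0_norm_eq_sum: "real (l0_norm y) = (\<Sum>i\<in>UNIV. of_bool (y $ i \<noteq> 0))"
  by (simp add: l0_norm_def of_bool_def sum.If_cases)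

lemma feasibleD:
  assumes "feasible x m M \<Phi>"
  shows "prob_space M" "\<Phi> \<in> borel_measurable M" "AE \<omega> in M. l0_norm (\<Phi> \<omega>) \<le> m"
    "integrable M (\<lambda>\<omega>. \<Phi> \<omega> $ i)" "(\<integral>\<omega>. \<Phi> \<omega> $ i \<partial>M) = x $ i"
proof -
  show "prob_space M" "\<Phi> \<in> borel_measurable M" "AE \<omega> in M. l0_norm (\<Phi> \<omega>) \<le> m"
    using assms by (auto simp: feasible_def)
  have "integrable M \<Phi>" "integral\<^sup>L M \<Phi> = x"
    using assms by (auto simp: feasible_def)
  then show "integrable M (\<lambda>\<omega>. \<Phi> \<omega> $ i)" "(\<integral>\<omega>. \<Phi> \<omega> $ i \<partial>M) = x $ i"
    using integrable_bounded_linear[OF bounded_linear_vec_nth, of M \<Phi> i]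
      integral_bounded_linear[OF bounded_linear_vec_nth, of M \<Phi> i] by auto
qed

text \<open>Affinity makes each expectation a function of \<open>x\<close> alone; complementary
  slackness then cancels \<open>\<tau>\<^sup>2 * m\<close> against the \<open>incl_prob\<close>
  terms.\<close>

lemma
  assumes "feasible x m M \<Phi>" "is_threshold x m \<tau>"
  shows integrable_tangent: "integrable M (\<lambda>\<omega>. (\<Sum>i\<in>UNIV. tangent \<tau> (x $ i) (\<Phi> \<omega> $ i)) - \<tau>\<^sup>2 * m)"
    and integral_tangent: "(\<integral>\<omega>. (\<Sum>i\<in>UNIV. tangent \<tau> (x $ i) (\<Phi> \<omega> $ i)) - \<tau>\<^sup>2 * m \<partial>M) = opt_value \<tau> x"
proof -
  interpret prob_space M by (rule feasibleD(1)[OF assms(1)])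
  note [simp] = feasibleD(4,5)[OF assms(1)]
  have int: "integrable M (\<lambda>\<omega>. tangent \<tau> (x $ i) (\<Phi> \<omega> $ i))" for i
    by (cases "\<bar>x $ i\<bar> > \<tau>") (simp_all add: tangent_def)
  then show "integrable M (\<lambda>\<omega>. (\<Sum>i\<in>UNIV. tangent \<tau> (x $ i) (\<Phi> \<omega> $ i)) - \<tau>\<^sup>2 * m)"
    by simp
  have E: "(\<integral>\<omega>. tangent \<tau> (x $ i) (\<Phi> \<omega> $ i) \<partial>M) = \<bar>x $ i\<bar> * max 0 (\<tau> - \<bar>x $ i\<bar>) + \<tau>\<^sup>2 * incl_prob \<tau> (x $ i)"
    for i
  proof (cases "\<bar>x $ i\<bar> > \<tau>")
    case True
    then show ?thesis by (simp add: tangent_def incl_prob_def prob_space)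
  next
    case False
    then have "\<tau>\<^sup>2 * incl_prob \<tau> (x $ i) = \<tau> * \<bar>x $ i\<bar>"
      by (cases "\<tau> = 0") (auto simp: incl_prob_def power2_eq_square)
    moreover have "(\<integral>\<omega>. tangent \<tau> (x $ i) (\<Phi> \<omega> $ i) \<partial>M) = 2 * \<tau> * (x $ i * sgn (x $ i)) - \<bar>x $ i\<bar> * \<bar>x $ i\<bar>"
      using False by (simp add: tangent_def prob_space power2_eq_square algebra_simps)
    ultimately show ?thesis using False
      by (simp add: algebra_simps flip: abs_sgn)
  qed
  have "\<tau>\<^sup>2 * (\<Sum>i\<in>UNIV. incl_prob \<tau> (x $ i)) = \<tau>\<^sup>2 * m"
    using assms(2) by (simp add: is_threshold_def power2_eq_square mult.assoc)
  then show "(\<integral>\<omega>. (\<Sum>i\<in>UNIV. tangent \<tau> (x $ i) (\<Phi> \<omega> $ i)) - \<tau>\<^sup>2 * m \<partial>M) = opt_value \<tau> x"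
    by (simp add: int E sum.distrib prob_space opt_value_def flip: sum_distrib_left)
qed

text \<open>Summing the one-coordinate inequalities turns the indicators into
  \<open>l0_norm y\<close>, which is at most \<open>m\<close>. The gaps are nonnegative, so equality
  in the sum forces each of them to vanish.\<close>

lemma
  assumes "0 \<le> \<tau>" "l0_norm y \<le> m"
  shows tangent_sum_le: "(\<Sum>i\<in>UNIV. tangent \<tau> (x $ i) (y $ i)) - \<tau>\<^sup>2 * m \<le> (norm (x - y))\<^sup>2"
    and tangent_sum_eqD: "(norm (x - y))\<^sup>2 \<le> (\<Sum>i\<in>UNIV. tangent \<tau> (x $ i) (y $ i)) - \<tau>\<^sup>2 * m
      \<Longrightarrow> y $ i \<in> opt_vals \<tau> (x $ i)"
proof -
  let ?g = "\<lambda>i. (x $ i - y $ i)\<^sup>2 + \<tau>\<^sup>2 * of_bool (y $ i \<noteq> 0) - tangent \<tau> (x $ i) (y $ i)"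
  have g: "0 \<le> ?g i" for i using tangent_le[OF assms(1)] by simp
  have "\<tau>\<^sup>2 * real (l0_norm y) \<le> \<tau>\<^sup>2 * m"
    using assms(2) by (intro mult_left_mono) auto
  moreover have "sum ?g UNIV = (norm (x - y))\<^sup>2 + \<tau>\<^sup>2 * real (l0_norm y) - (\<Sum>i\<in>UNIV. tangent \<tau> (x $ i) (y $ i))"
    by (simp only: sum.distrib sum_subtractf power2_norm_diff_vec l0_norm_eq_sum sum_distrib_left)
  ultimately have le: "sum ?g UNIV \<le> (norm (x - y))\<^sup>2 - ((\<Sum>i\<in>UNIV. tangent \<tau> (x $ i) (y $ i)) - \<tau>\<^sup>2 * m)"
    by simp
  with sum_nonneg[of UNIV ?g] g
  show "(\<Sum>i\<in>UNIV. tangent \<tau> (x $ i) (y $ i)) - \<tau>\<^sup>2 * m \<le> (norm (x - y))\<^sup>2"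
    by force
  assume "(norm (x - y))\<^sup>2 \<le> (\<Sum>i\<in>UNIV. tangent \<tau> (x $ i) (y $ i)) - \<tau>\<^sup>2 * m"
  with le have "sum ?g UNIV \<le> 0" by linarith
  moreover have "?g i \<le> sum ?g UNIV" by (rule member_le_sum) (use g in auto)
  ultimately show "y $ i \<in> opt_vals \<tau> (x $ i)"
    by (intro tangent_eqD[OF assms(1)]) simp
qed

text \<open>The comparison with the tangents uses Bochner integrals; a finite objective supplies the
  integrability.\<close>

lemma
  assumes "feasible x m M \<Phi>" "objective x M \<Phi> < \<infinity>"
  shows integrable_objective: "integrable M (\<lambda>\<omega>. (norm (x - \<Phi> \<omega>))\<^sup>2)"
    and objective_eq_integral: "objective x M \<Phi> = ennreal (\<integral>\<omega>. (norm (x - \<Phi> \<omega>))\<^sup>2 \<partial>M)"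
proof -
  note [measurable] = feasibleD(2)[OF assms(1)]
  show int: "integrable M (\<lambda>\<omega>. (norm (x - \<Phi> \<omega>))\<^sup>2)"
    using assms(2) by (intro integrableI_nonneg) (auto simp: objective_def)
  show "objective x M \<Phi> = ennreal (\<integral>\<omega>. (norm (x - \<Phi> \<omega>))\<^sup>2 \<partial>M)"
    unfolding objective_def by (rule nn_integral_eq_integral[OF int]) simp
qed

lemma objective_ge:
  assumes f: "feasible x m M \<Phi>" and t: "is_threshold x m \<tau>"
  shows "ennreal (opt_value \<tau> x) \<le> objective x M \<Phi>"
proof (cases "objective x M \<Phi> < \<infinity>")
  case True
  have t0: "0 \<le> \<tau>" using t by (simp add: is_threshold_def)
  have "opt_value \<tau> x \<le> (\<integral>\<omega>. (norm (x - \<Phi> \<omega>))\<^sup>2 \<partial>M)"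
    unfolding integral_tangent[OF f t, symmetric]
  proof (rule integral_mono_AE[OF integrable_tangent[OF f t] integrable_objective[OF f True]])
    show "AE \<omega> in M. (\<Sum>i\<in>UNIV. tangent \<tau> (x $ i) (\<Phi> \<omega> $ i)) - \<tau>\<^sup>2 * m \<le> (norm (x - \<Phi> \<omega>))\<^sup>2"
      using feasibleD(3)[OF f] by eventually_elim (rule tangent_sum_le[OF t0])
  qed
  then show ?thesis
    unfolding objective_eq_integral[OF f True] by (rule ennreal_leI)
qed (simp add: not_less top_unique)

text \<open>The squared error minus its tangent bound is almost surely nonnegative and has integral
  0, hence vanishes almost surely.\<close>

lemma objective_eqD:
  assumes f: "feasible x m M \<Phi>" and t: "is_threshold x m \<tau>"
    and eq: "objective x M \<Phi> = ennreal (opt_value \<tau> x)"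
  shows "AE \<omega> in M. \<Phi> \<omega> $ i \<in> opt_vals \<tau> (x $ i)"
proof -
  have t0: "0 \<le> \<tau>" using t by (simp add: is_threshold_def)
  have fin: "objective x M \<Phi> < \<infinity>" using eq by simp
  let ?B = "\<lambda>\<omega>. (\<Sum>i\<in>UNIV. tangent \<tau> (x $ i) (\<Phi> \<omega> $ i)) - \<tau>\<^sup>2 * m"
  let ?Q = "\<lambda>\<omega>. (norm (x - \<Phi> \<omega>))\<^sup>2"
  note int = integrable_tangent[OF f t] integrable_objective[OF f fin]
  have "(\<integral>\<omega>. ?Q \<omega> \<partial>M) = opt_value \<tau> x"
    using eq objective_eq_integral[OF f fin] opt_value_nonneg[of \<tau> x]
    by (simp add: ennreal_inj)
  then have "(\<integral>\<omega>. ?Q \<omega> - ?B \<omega> \<partial>M) = 0"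
    using integral_tangent[OF f t] int by (subst Bochner_Integration.integral_diff) auto
  moreover have "AE \<omega> in M. 0 \<le> ?Q \<omega> - ?B \<omega>"
    using feasibleD(3)[OF f] by eventually_elim (use tangent_sum_le[OF t0] in simp)
  ultimately have "AE \<omega> in M. ?Q \<omega> - ?B \<omega> = 0"
    using integral_nonneg_eq_0_iff_AE[OF Bochner_Integration.integrable_diff[OF int(2,1)]] by blast
  then show ?thesis
    using feasibleD(3)[OF f]
    by eventually_elim (rule tangent_sum_eqD[OF t0], auto)
qed

lemma objective_eqI:
  assumes f: "feasible x m M \<Phi>"
    and AE: "\<And>i. AE \<omega> in M. \<Phi> \<omega> $ i \<in> opt_vals \<tau> (x $ i)"
  shows "objective x M \<Phi> = ennreal (opt_value \<tau> x)"
proof -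
  interpret prob_space M by (rule feasibleD(1)[OF f])
  note [simp] = feasibleD(4,5)[OF f]
  \<comment> \<open>In the second case of \<open>opt_vals\<close> one has
    \<open>y\<^sup>2 = \<tau> * sgn a * y\<close>, so on contact points the squared error is itself
    affine in \<open>y\<close> and its expectation depends on \<open>x\<close> only.\<close>
  define h where "h a y = (if \<bar>a\<bar> > \<tau> then 0 else (\<tau> * sgn a - 2 * a) * y + a\<^sup>2)" for a y :: real
  have h: "(a - y)\<^sup>2 = h a y" if "y \<in> opt_vals \<tau> a" for a y
    using that by (auto simp: h_def opt_vals_def power2_eq_square algebra_simps split: if_splits)
  have "AE \<omega> in M. \<forall>i. \<Phi> \<omega> $ i \<in> opt_vals \<tau> (x $ i)"
    using AE by (simp add: AE_all_countable)
  then have Q: "AE \<omega> in M. (norm (x - \<Phi> \<omega>))\<^sup>2 = (\<Sum>i\<in>UNIV. h (x $ i) (\<Phi> \<omega> $ i))"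
    by eventually_elim (simp add: power2_norm_diff_vec h)
  have int: "integrable M (\<lambda>\<omega>. h (x $ i) (\<Phi> \<omega> $ i))" for i
    by (cases "\<bar>x $ i\<bar> > \<tau>") (simp_all add: h_def)
  have E: "(\<integral>\<omega>. h (x $ i) (\<Phi> \<omega> $ i) \<partial>M) = \<bar>x $ i\<bar> * max 0 (\<tau> - \<bar>x $ i\<bar>)" for i
  proof (cases "\<bar>x $ i\<bar> > \<tau>")
    case False
    then have "(\<integral>\<omega>. h (x $ i) (\<Phi> \<omega> $ i) \<partial>M) = \<tau> * (x $ i * sgn (x $ i)) - \<bar>x $ i\<bar> * \<bar>x $ i\<bar>"
      by (simp add: h_def prob_space power2_eq_square algebra_simps)
    with False show ?thesis
      by (simp add: algebra_simps flip: abs_sgn)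
  qed (simp add: h_def)
  have "objective x M \<Phi> = (\<integral>\<^sup>+\<omega>. ennreal (\<Sum>i\<in>UNIV. h (x $ i) (\<Phi> \<omega> $ i)) \<partial>M)"
    unfolding objective_def by (rule nn_integral_cong_AE) (use Q in eventually_elim, simp)
  also have "\<dots> = ennreal (\<integral>\<omega>. (\<Sum>i\<in>UNIV. h (x $ i) (\<Phi> \<omega> $ i)) \<partial>M)"
  proof (rule nn_integral_eq_integral)
    show "AE \<omega> in M. 0 \<le> (\<Sum>i\<in>UNIV. h (x $ i) (\<Phi> \<omega> $ i))"
      using Q by eventually_elim (metis zero_le_power2)
  qed (use int in simp)
  also have "(\<integral>\<omega>. (\<Sum>i\<in>UNIV. h (x $ i) (\<Phi> \<omega> $ i)) \<partial>M) = opt_value \<tau> x"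
    by (simp add: int E opt_value_def)
  finally show ?thesis .
qed

section \<open>Systematic sampling\<close>

lemma prob_space_uniform_unit: "prob_space (uniform_measure lborel {0..<1::real})"
  by (rule prob_space_uniform_measure) auto

text \<open>The shift by \<open>u\<close> reaches the next integer exactly when
  \<open>u \<ge> 1 - frac c\<close>, an event of probability \<open>frac c\<close>; rounding after a
  uniform shift is therefore unbiased.\<close>

lemma
  fixes c :: real
  defines "U \<equiv> uniform_measure lborel {0..<1::real}"
  shows integrable_floor_shift: "integrable U (\<lambda>u. real_of_int \<lfloor>c + u\<rfloor>)"
    and integral_floor_shift: "(\<integral>u. real_of_int \<lfloor>c + u\<rfloor> \<partial>U) = c"
proof -
  interpret prob_space U unfolding U_def by (rule prob_space_uniform_unit)
  have [measurable_cong]: "sets U = sets borel" by (simp add: U_def)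
  have AE: "AE u in U. real_of_int \<lfloor>c + u\<rfloor> = real_of_int \<lfloor>c\<rfloor> + indicator {1 - frac c..<1} u"
    unfolding U_def
  proof (rule AE_uniform_measureI)
    show "AE u in lborel. u \<in> {0..<1} \<longrightarrow>
        real_of_int \<lfloor>c + u\<rfloor> = real_of_int \<lfloor>c\<rfloor> + indicator {1 - frac c..<1} u"
    proof (intro AE_I2 impI)
      fix u :: real assume "u \<in> {0..<1}"
      then have "\<lfloor>c + u\<rfloor> = \<lfloor>c\<rfloor> + (if 1 - frac c \<le> u then 1 else 0)"
        by (intro floor_unique) (auto simp: frac_def, linarith+)
      then show "real_of_int \<lfloor>c + u\<rfloor> = real_of_int \<lfloor>c\<rfloor> + indicator {1 - frac c..<1} u"
        using \<open>u \<in> {0..<1}\<close> by (simp add: indicator_def)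
    qed
  qed simp
  have int: "integrable U (\<lambda>u. real_of_int \<lfloor>c\<rfloor> + indicator {1 - frac c..<1} u)"
    by (simp add: emeasure_eq_measure)
  show "integrable U (\<lambda>u. real_of_int \<lfloor>c + u\<rfloor>)"
    by (subst integrable_cong_AE[OF _ _ AE]) (use int in auto)
  have "{0..<1} \<inter> {1 - frac c..<1} = {1 - frac c..<1}"
    using frac_lt_1[of c] by auto
  then have "measure U {1 - frac c..<1} = frac c"
    unfolding U_def by (subst measure_uniform_measure) auto
  then show "(\<integral>u. real_of_int \<lfloor>c + u\<rfloor> \<partial>U) = c"
    by (subst integral_cong_AE[OF _ _ AE]) (auto simp: prob_space emeasure_eq_measure frac_def)
qed

text \<open>Systematic sampling: lay intervals of lengths \<open>p 0, p 1, \<dots>\<close> end to end; \<open>j\<close> is selected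
  when its interval, shifted by a uniform \<open>u\<close>, catches an integer.\<close>

lemma systematic_sampling_nat:
  fixes p :: "nat \<Rightarrow> real" and n m :: nat
  defines "U \<equiv> uniform_measure lborel {0..<1::real}"
  assumes p: "\<And>j. j < n \<Longrightarrow> 0 \<le> p j" "\<And>j. j < n \<Longrightarrow> p j \<le> 1" and le: "(\<Sum>j<n. p j) \<le> real m"
  shows "\<exists>A :: nat \<Rightarrow> real set. (\<forall>j. A j \<in> sets borel) \<and> (\<forall>j<n. measure U (A j) = p j) \<and>
    (\<forall>u. card {j\<in>{..<n}. u \<in> A j} \<le> m)"
proof -
  interpret prob_space U unfolding U_def by (rule prob_space_uniform_unit)
  have [measurable_cong]: "sets U = sets borel" by (simp add: U_def)
  define P where "P j = (\<Sum>i<j. p i)" for j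
  define F where "F j u = \<lfloor>P j + u\<rfloor>" for j u
  define A where "A j = {u. F (Suc j) u \<noteq> F j u}" for j
  have [measurable]: "F j \<in> borel \<rightarrow>\<^sub>M count_space UNIV" for j
    unfolding F_def by measurable
  have A[measurable]: "A j \<in> sets borel" for j
    unfolding A_def by measurable
  \<comment> \<open>As \<open>0 \<le> p j \<le> 1\<close>, the floor rises by 0 or 1. Selection thus
    becomes a difference of floors, which has a known mean and telescopes when counted.\<close>
  have ind: "F (Suc j) u - F j u = of_bool (u \<in> A j)" if "j < n" for j u
  proof -
    have "F j u \<le> F (Suc j) u"
      unfolding F_def P_def by (rule floor_mono) (use p[OF that] in simp)
    moreover have "F (Suc j) u \<le> \<lfloor>P j + u + 1\<rfloor>"
      unfolding F_def P_def by (rule floor_mono) (use p[OF that] in simp)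
    moreover have "\<lfloor>P j + u + 1\<rfloor> = F j u + 1"
      by (simp add: F_def)
    ultimately show ?thesis by (cases "F (Suc j) u = F j u") (auto simp: A_def)
  qed
  have "measure U (A j) = p j" if "j < n" for j
  proof -
    have "measure U (A j) = (\<integral>u. indicator (A j) u \<partial>U)"
      by (simp add: U_def)
    also have "\<dots> = (\<integral>u. real_of_int (F (Suc j) u) - real_of_int (F j u) \<partial>U)"
      by (intro Bochner_Integration.integral_cong refl, unfold of_int_diff[symmetric] ind[OF that])
        (simp add: indicator_def)
    also have "\<dots> = P (Suc j) - P j"
      unfolding F_def U_def
      by (simp add: integrable_floor_shift integral_floor_shift)
    finally show ?thesis by (simp add: P_def)
  qed
  moreover have "card {j\<in>{..<n}. u \<in> A j} \<le> m" for u
  proof -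
    have "int (card {j\<in>{..<n}. u \<in> A j}) = (\<Sum>j<n. of_bool (u \<in> A j))"
      by (simp add: of_bool_def sum.If_cases Int_def)
    also have "\<dots> = (\<Sum>j<n. F (Suc j) u - F j u)"
      by (simp add: ind)
    also have "\<dots> = F n u - F 0 u"
      by (rule sum_lessThan_telescope)
    also have "\<dots> \<le> int m"
    proof -
      \<comment> \<open>The integer \<open>m\<close> can be taken out of the floor, so rounding
        loses nothing and the bound holds for every \<open>u\<close>.\<close>
      have "F n u \<le> \<lfloor>u + real m\<rfloor>"
        using le unfolding F_def P_def by (intro floor_mono) simp
      also have "\<dots> = \<lfloor>u\<rfloor> + int m"
        using floor_add_int[of u "int m"] by simp
      finally show ?thesis by (simp add: F_def P_def)
    qed
    finally show ?thesis by simp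
  qed
  ultimately show ?thesis
    by (intro exI[of _ A] conjI allI impI A)
qed

lemma systematic_sampling:
  fixes p :: "'n::finite \<Rightarrow> real" and m :: nat
  defines "U \<equiv> uniform_measure lborel {0..<1::real}"
  assumes p: "\<And>i. 0 \<le> p i" "\<And>i. p i \<le> 1" and le: "(\<Sum>i\<in>UNIV. p i) \<le> real m"
  shows "\<exists>A :: 'n \<Rightarrow> real set. (\<forall>i. A i \<in> sets borel) \<and> (\<forall>i. measure U (A i) = p i) \<and>
    (\<forall>u. card {i. u \<in> A i} \<le> m)"
proof -
  obtain h where h: "bij_betw h {..<CARD('n)} (UNIV :: 'n set)"
    using ex_bij_betw_nat_finite[OF finite, of "UNIV :: 'n set"] unfolding atLeast0LessThan by blast
  let ?g = "inv_into {..<CARD('n)} h"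
  have g: "bij_betw ?g UNIV {..<CARD('n)}"
    by (rule bij_betw_inv_into[OF h])
  have hg: "h (?g i) = i" "?g i < CARD('n)" for i
    using bij_betw_inv_into_right[OF h, of i] bij_betw_apply[OF g, of i] by simp_all
  have le': "(\<Sum>j<CARD('n). p (h j)) \<le> real m"
    using le sum.reindex_bij_betw[OF h, of p] by simp
  obtain A :: "nat \<Rightarrow> real set" where A: "\<And>j. A j \<in> sets borel" "\<And>j. j < CARD('n) \<Longrightarrow> measure U (A j) = p (h j)"
    "\<And>u. card {j\<in>{..<CARD('n)}. u \<in> A j} \<le> m"
    using systematic_sampling_nat[where p = "\<lambda>j. p (h j)", OF p(1) p(2) le'] unfolding U_def by metis
  show ?thesis
  proof (intro exI[of _ "\<lambda>i. A (?g i)"] conjI allI)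
    show "A (?g i) \<in> sets borel" for i by (rule A(1))
    show "measure U (A (?g i)) = p i" for i by (simp only: A(2) hg)
    fix u
    have "card {i. u \<in> A (?g i)} \<le> card {j\<in>{..<CARD('n)}. u \<in> A j}"
    proof (rule card_inj_on_le)
      show "inj_on ?g {i. u \<in> A (?g i)}"
        by (rule inj_on_subset[OF bij_betw_imp_inj_on[OF g]]) simp
      show "?g ` {i. u \<in> A (?g i)} \<subseteq> {j \<in> {..<CARD('n)}. u \<in> A j}"
        by (rule image_subsetI) (simp add: hg(2))
    qed simp
    then show "card {i. u \<in> A (?g i)} \<le> m" using A(3) by (rule order_trans)
  qed
qed

section \<open>Attainment and the characterization of minimizers by contact points\<close>

lemma incl_prob_bounds: "0 \<le> \<tau> \<Longrightarrow> 0 \<le> incl_prob \<tau> a" "0 \<le> \<tau> \<Longrightarrow> incl_prob \<tau> a \<le> 1"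
  by (auto simp: incl_prob_def divide_le_eq_1)

text \<open>Coordinate \<open>i\<close> is selected with probability
  \<open>incl_prob \<tau> (x $ i)\<close> and the selected entry is divided by it (Horvitz-Thompson
  weights). This is unbiased, and almost surely every value is a contact point.\<close>

lemma exists_optimal:
  fixes x :: "real ^ 'n::finite"
  assumes t: "is_threshold x m \<tau>"
  obtains N :: "(real ^ 'n) measure" and \<Psi>
  where "feasible x m N \<Psi>" "objective x N \<Psi> = ennreal (opt_value \<tau> x)"
proof -
  let ?U = "uniform_measure lborel {0..<1::real}"
  let ?p = "\<lambda>i. incl_prob \<tau> (x $ i)"
  interpret prob_space ?U by (rule prob_space_uniform_unit)
  have t0: "0 \<le> \<tau>" using t by (simp add: is_threshold_def)
  obtain A :: "'n \<Rightarrow> real set" where A[measurable]: "\<And>i. A i \<in> sets borel"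
    and pA: "\<And>i. measure ?U (A i) = ?p i" and card: "\<And>u. card {i. u \<in> A i} \<le> m"
    using systematic_sampling[of ?p m, OF incl_prob_bounds[OF t0]] t
    unfolding is_threshold_def by metis
  define v where "v i = x $ i / ?p i" for i
  define \<Psi> :: "real \<Rightarrow> real ^ 'n" where "\<Psi> u = (\<Sum>i\<in>UNIV. indicator (A i) u *\<^sub>R axis i (v i))" for u
  have nth: "\<Psi> u $ i = indicator (A i) u * v i" for u i
    by (simp add: \<Psi>_def axis_def of_bool_def if_distrib[of "\<lambda>z. indicator _ u * z"] cong: if_cong)
  have int: "integrable ?U (\<lambda>u. indicator (A i) u :: real)" for i
    by (simp add: emeasure_eq_measure)
  have v: "?p i *\<^sub>R axis i (v i) = axis i (x $ i)" for i
  proof -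
    \<comment> \<open>An inclusion probability vanishes only at a zero entry, where the default
      \<open>v i = 0 / 0 = 0\<close> is the right value.\<close>
    have "?p i = 0 \<Longrightarrow> x $ i = 0"
      using t0 by (auto simp: incl_prob_def split: if_splits)
    then have "?p i * v i = x $ i" by (simp add: v_def)
    then show ?thesis by (simp add: axis_def vec_eq_iff)
  qed
  have "integrable ?U \<Psi>"
    unfolding \<Psi>_def using int by (intro Bochner_Integration.integrable_sum integrable_scaleR_left) auto
  moreover have "integral\<^sup>L ?U \<Psi> = (\<Sum>i\<in>UNIV. ?p i *\<^sub>R axis i (v i))"
    unfolding \<Psi>_def using int pA by (subst Bochner_Integration.integral_sum) auto
  moreover have "(\<Sum>i\<in>UNIV. ?p i *\<^sub>R axis i (v i)) = x"
    unfolding v by (simp add: vec_eq_iff axis_def if_distrib cong: if_cong)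
  moreover have "l0_norm (\<Psi> u) \<le> m" for u
  proof -
    have "l0_norm (\<Psi> u) \<le> card {i. u \<in> A i}"
      unfolding l0_norm_def by (rule card_mono) (auto simp: nth indicator_def split: if_splits)
    then show ?thesis using card by (rule order_trans)
  qed
  ultimately have f: "feasible x m ?U \<Psi>"
    by (auto simp: feasible_def prob_space_axioms)
  have "AE u in ?U. \<Psi> u $ i \<in> opt_vals \<tau> (x $ i)" for i
  proof (cases "\<bar>x $ i\<bar> > \<tau>")
    case True
    then have "measure ?U (A i) = 1" by (simp add: pA incl_prob_def)
    then have "AE u in ?U. u \<in> A i" by (subst (asm) prob_eq_1) simp_all
    then show ?thesis
      by eventually_elim (use True in \<open>simp add: nth v_def incl_prob_def opt_vals_def\<close>)
  next
    case False
    then have "v i = \<tau> * sgn (x $ i)"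
      by (auto simp: v_def incl_prob_def sgn_if field_simps)
    with False show ?thesis
      by (auto simp: nth opt_vals_def indicator_def)
  qed
  then have "objective x ?U \<Psi> = ennreal (opt_value \<tau> x)"
    by (rule objective_eqI[OF f])
  \<comment> \<open>The sample lives on \<open>real\<close>; its law is a competitor over
    \<open>real ^ 'n\<close>, the type over which \<open>is_minimizer\<close> quantifies.\<close>
  then show thesis
    by (intro that[OF feasible_distr(1)[OF f]]) (simp only: feasible_distr(2)[OF f])
qed

text \<open>Attainment identifies the minimum with \<open>opt_value \<tau> x\<close>;
  \<open>objective_eqD\<close> and \<open>objective_eqI\<close> then give the two
  directions.\<close>

lemma is_minimizer_iff_opt_vals:
  fixes x :: "real ^ 'n::finite"
  assumes t: "is_threshold x m \<tau>" and f: "feasible x m M \<Phi>"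
  shows "is_minimizer x m M \<Phi> \<longleftrightarrow> (\<forall>i. AE \<omega> in M. \<Phi> \<omega> $ i \<in> opt_vals \<tau> (x $ i))"
proof
  assume min: "is_minimizer x m M \<Phi>"
  obtain N :: "(real ^ 'n) measure" and \<Psi>
    where "feasible x m N \<Psi>" and opt: "objective x N \<Psi> = ennreal (opt_value \<tau> x)"
    using exists_optimal[OF t] .
  then have "objective x M \<Phi> \<le> ennreal (opt_value \<tau> x)"
    using is_minimizer_le[OF min] by (metis opt)
  then have "objective x M \<Phi> = ennreal (opt_value \<tau> x)"
    using objective_ge[OF f t] by (rule antisym)
  with objective_eqD[OF f t] show "\<forall>i. AE \<omega> in M. \<Phi> \<omega> $ i \<in> opt_vals \<tau> (x $ i)" by blast
next
  assume "\<forall>i. AE \<omega> in M. \<Phi> \<omega> $ i \<in> opt_vals \<tau> (x $ i)"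
  then have "objective x M \<Phi> = ennreal (opt_value \<tau> x)"
    using objective_eqI[OF f] by blast
  with f show "is_minimizer x m M \<Phi>"
    unfolding is_minimizer_def by (simp add: objective_ge[OF _ t])
qed

text \<open>The mean determines a law on two points, so the probability in property 2 follows from
  the support and unbiasedness.\<close>

lemma feasible_prob_opt_val:
  assumes f: "feasible x m M \<Phi>" and "0 < \<tau>" "x $ i \<noteq> 0"
    and AE: "AE \<omega> in M. \<Phi> \<omega> $ i = \<tau> * sgn (x $ i) \<or> \<Phi> \<omega> $ i = 0"
  shows "measure M {\<omega> \<in> space M. \<Phi> \<omega> $ i = \<tau> * sgn (x $ i)} = \<bar>x $ i\<bar> / \<tau>"
proof -
  interpret prob_space M by (rule feasibleD(1)[OF f])
  note [measurable] = borel_measurable_integrable[OF feasibleD(4)[OF f]]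
  let ?S = "{\<omega> \<in> space M. \<Phi> \<omega> $ i = \<tau> * sgn (x $ i)}"
  have "x $ i = (\<integral>\<omega>. \<Phi> \<omega> $ i \<partial>M)" by (simp add: feasibleD(5)[OF f])
  also have "\<dots> = (\<integral>\<omega>. \<tau> * sgn (x $ i) * indicator ?S \<omega> \<partial>M)"
  proof (rule integral_cong_AE)
    show "AE \<omega> in M. \<Phi> \<omega> $ i = \<tau> * sgn (x $ i) * indicator ?S \<omega>"
      using AE AE_space by eventually_elim (auto simp: indicator_def)
  qed measurable
  also have "\<dots> = \<tau> * sgn (x $ i) * measure M ?S"
    by simp
  finally show ?thesis
    using assms(2,3) by (auto simp: sgn_if field_simps split: if_splits)
qed

section \<open>The smallest admissible \<open>k\<close> and its threshold\<close>

text \<open>The denominator is cleared; the first disjunct reflects that division by zero yields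
  0.\<close>

lemma keep_prob_le_1_iff:
  fixes x :: "real ^ 'n::finite"
  shows "keep_prob x m \<alpha> k i \<le> 1 \<longleftrightarrow> (\<Sum>l = k+1..CARD('n). \<bar>x $ \<alpha> l\<bar>) = 0 \<or>
    (real m - real k) * \<bar>x $ \<alpha> i\<bar> \<le> (\<Sum>l = k+1..CARD('n). \<bar>x $ \<alpha> l\<bar>)"
proof -
  have "a / S \<le> 1 \<longleftrightarrow> S = 0 \<or> a \<le> S" if "0 \<le> S" for a S :: real
    using that by (auto simp: divide_le_eq_1)
  then show ?thesis
    unfolding keep_prob_def by (simp add: sum_nonneg)
qed

text \<open>At \<open>m - 1\<close> the numerator is a single
  \<open>\<bar>x $ \<alpha> i\<bar>\<close>, a summand of the denominator, so \<open>m - 1\<close>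
  is admissible. This makes \<open>real m - real k\<close> positive.\<close>

lemma k_smallest_less:
  assumes "m \<ge> 1" "k_smallest x m \<alpha> k"
  shows "k < m"
proof (rule ccontr)
  assume "\<not> k < m"
  moreover have "probs_le_1 x m \<alpha> (m - 1)"
    unfolding probs_le_1_def
  proof
    fix i assume "i \<in> {m - 1 + 1..CARD('a)}"
    then have "\<bar>x $ \<alpha> i\<bar> \<le> (\<Sum>l = m - 1 + 1..CARD('a). \<bar>x $ \<alpha> l\<bar>)"
      by (intro member_le_sum) auto
    then show "keep_prob x m \<alpha> (m - 1) i \<le> 1"
      using assms(1) unfolding keep_prob_le_1_iff by (simp add: of_nat_diff)
  qed
  ultimately show False
    using assms by (auto simp: k_smallest_def)
qed

text \<open>The ratio is the multiplier \<open>\<tau>\<close>. Minimality of \<open>k\<close> puts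
  the first \<open>k\<close> entries above it, admissibility of \<open>k\<close> keeps the others
  from exceeding it.\<close>

lemma k_smallest_abs_gt_iff:
  fixes x :: "real ^ 'n::finite"
  assumes mono: "\<And>i j. 1 \<le> i \<Longrightarrow> i \<le> j \<Longrightarrow> j \<le> CARD('n) \<Longrightarrow> \<bar>x $ \<alpha> i\<bar> \<ge> \<bar>x $ \<alpha> j\<bar>"
    and "m \<ge> 1" and k: "k_smallest x m \<alpha> k" "k \<le> CARD('n)" and i: "i \<in> {1..CARD('n)}"
  shows "\<bar>x $ \<alpha> i\<bar> > (\<Sum>l = k+1..CARD('n). \<bar>x $ \<alpha> l\<bar>) / (real m - real k) \<longleftrightarrow> i \<le> k"
proof -
  let ?S = "\<lambda>k. \<Sum>l = k+1..CARD('n). \<bar>x $ \<alpha> l\<bar>"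
  have km: "k < m" using k_smallest_less assms by blast
  show ?thesis
  proof (cases "i \<le> k")
    case True
    with i have k1: "1 \<le> k" by simp
    \<comment> \<open>Minimality enters through \<open>k - 1\<close>: some entry violates the bound
      there, hence so does the largest candidate \<open>\<alpha> k\<close>.\<close>
    with k(1) obtain j where j: "j \<in> {k - 1 + 1..CARD('n)}" "\<not> keep_prob x m \<alpha> (k - 1) j \<le> 1"
      unfolding k_smallest_def probs_le_1_def by (metis diff_less zero_less_one less_le_trans)
    have Sk: "?S (k - 1) = \<bar>x $ \<alpha> k\<bar> + ?S k"
      using k1 k(2) sum.atLeast_Suc_atMost[of k "CARD('n)" "\<lambda>l. \<bar>x $ \<alpha> l\<bar>"] by simp
    have "?S (k - 1) < (real m - real (k - 1)) * \<bar>x $ \<alpha> j\<bar>"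
      using j(2) unfolding keep_prob_le_1_iff by simp
    also have "\<dots> \<le> (real m - real (k - 1)) * \<bar>x $ \<alpha> k\<bar>"
      using j(1) k1 km mono[of k j] by (intro mult_left_mono) auto
    \<comment> \<open>Subtracting \<open>\<bar>x $ \<alpha> k\<bar>\<close> from both sides lowers
      the factor from \<open>m - (k - 1)\<close> to \<open>m - k\<close>.\<close>
    finally have "?S k < (real m - real k) * \<bar>x $ \<alpha> k\<bar>"
      using Sk k1 by (simp add: of_nat_diff algebra_simps)
    also have "\<dots> \<le> (real m - real k) * \<bar>x $ \<alpha> i\<bar>"
      using True i k(2) km mono[of i k] by (intro mult_left_mono) auto
    finally show ?thesis
      using True km by (simp add: divide_less_eq mult.commute)
  next
    case False
    with i have i': "i \<in> {k+1..CARD('n)}" by simp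
    \<comment> \<open>Needed for the disjunct with \<open>?S k = 0\<close>, where the entry must
      vanish too.\<close>
    then have le: "\<bar>x $ \<alpha> i\<bar> \<le> ?S k" by (intro member_le_sum) auto
    have "keep_prob x m \<alpha> k i \<le> 1"
      using k(1) i' unfolding k_smallest_def probs_le_1_def by blast
    with le have "(real m - real k) * \<bar>x $ \<alpha> i\<bar> \<le> ?S k"
      unfolding keep_prob_le_1_iff by auto
    then show ?thesis
      using False km by (simp add: divide_less_eq mult.commute not_less)
  qed
qed

section \<open>From contact points to the three properties\<close>

theorem proposition5p2:
  fixes x :: "real ^ 'n::finite" and m :: nat and \<alpha> :: "nat \<Rightarrow> 'n"
  assumes "m \<ge> 1"
    and "bij_betw \<alpha> {1..CARD('n)} UNIV"
    and "\<And>i j. 1 \<le> i \<Longrightarrow> i \<le> j \<Longrightarrow> j \<le> CARD('n) \<Longrightarrow> \<bar>x $ \<alpha> i\<bar> \<ge> \<bar>x $ \<alpha> j\<bar>"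
  shows "(\<exists>(N :: (real ^ 'n) measure) \<Psi>. is_minimizer x m N \<Psi>) \<and>
    (\<forall>(M :: 'w measure) (\<Phi> :: 'w \<Rightarrow> real ^ 'n). feasible x m M \<Phi> \<longrightarrow>
       (is_minimizer x m M \<Phi> \<longleftrightarrow>
        (\<exists>k\<le>CARD('n). preserves_largest x \<alpha> k M \<Phi> \<and> perturbs_rest x m \<alpha> k M \<Phi> \<and>
                       k_smallest x m \<alpha> k)))"
proof -
  define k where "k = (LEAST k. probs_le_1 x m \<alpha> k)"
  \<comment> \<open>The condition is vacuous at \<open>CARD('n)\<close>, so a least admissible index
    exists.\<close>
  have top: "probs_le_1 x m \<alpha> CARD('n)" by (simp add: probs_le_1_def)
  have kn: "k \<le> CARD('n)" unfolding k_def using top by (rule Least_le)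
  have k: "k_smallest x m \<alpha> k"
    unfolding k_smallest_def k_def using LeastI[of "probs_le_1 x m \<alpha>", OF top] not_less_Least by blast
  have k_unique: "j = k" if "k_smallest x m \<alpha> j" for j
    using that k unfolding k_smallest_def by (metis nat_neq_iff)
  have km: "k < m" by (rule k_smallest_less[OF assms(1) k])
  define S where "S = (\<Sum>l = k+1..CARD('n). \<bar>x $ \<alpha> l\<bar>)"
  \<comment> \<open>Chosen so that \<open>\<bar>x $ \<alpha> i\<bar> / \<tau>\<close> is exactly
    \<open>keep_prob x m \<alpha> k i\<close>.\<close>
  define \<tau> where "\<tau> = S / (real m - real k)"
  have S0: "0 \<le> S" unfolding S_def by (intro sum_nonneg) auto
  have t0: "0 \<le> \<tau>" using S0 km by (simp add: \<tau>_def)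
  have gt: "\<bar>x $ \<alpha> i\<bar> > \<tau> \<longleftrightarrow> i \<le> k" if "i \<in> {1..CARD('n)}" for i
    unfolding \<tau>_def S_def using assms(1,3) k kn that by (intro k_smallest_abs_gt_iff) auto
  have keep: "keep_prob x m \<alpha> k i = \<bar>x $ \<alpha> i\<bar> / \<tau>" for i
    unfolding keep_prob_def \<tau>_def S_def[symmetric] by (simp add: mult.commute)
  have split: "{1..CARD('n)} = {1..k} \<union> {k+1..CARD('n)}"
    using kn by auto
  \<comment> \<open>The first \<open>k\<close> entries contribute 1 each, the others
    \<open>S / \<tau>\<close>, which equals \<open>m - k\<close> unless
    \<open>S = 0\<close>.\<close>
  have "(\<Sum>i\<in>UNIV. incl_prob \<tau> (x $ i)) = (\<Sum>i\<in>{1..CARD('n)}. incl_prob \<tau> (x $ \<alpha> i))"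
    by (rule sum.reindex_bij_betw[OF assms(2), symmetric])
  also note split
  also have "(\<Sum>i\<in>{1..k} \<union> {k+1..CARD('n)}. incl_prob \<tau> (x $ \<alpha> i)) =
      (\<Sum>i\<in>{1..k}. incl_prob \<tau> (x $ \<alpha> i)) + (\<Sum>i\<in>{k+1..CARD('n)}. incl_prob \<tau> (x $ \<alpha> i))"
    by (rule sum.union_disjoint) auto
  also have "(\<Sum>i\<in>{1..k}. incl_prob \<tau> (x $ \<alpha> i)) = (\<Sum>i\<in>{1..k}. 1)"
    using gt kn by (intro sum.cong) (auto simp: incl_prob_def)
  also have "(\<Sum>i\<in>{k+1..CARD('n)}. incl_prob \<tau> (x $ \<alpha> i)) = (\<Sum>i\<in>{k+1..CARD('n)}. \<bar>x $ \<alpha> i\<bar> / \<tau>)"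
    using gt by (intro sum.cong) (auto simp: incl_prob_def)
  finally have sum: "(\<Sum>i\<in>UNIV. incl_prob \<tau> (x $ i)) = real k + S / \<tau>"
    by (simp add: S_def sum_divide_distrib)
  have t: "is_threshold x m \<tau>"
  proof (cases "S = 0")
    case False
    then have "S / \<tau> = real m - real k" using km by (simp add: \<tau>_def)
    then show ?thesis unfolding is_threshold_def sum using t0 by simp
  next
    case True
    then have "\<tau> = 0" by (simp add: \<tau>_def)
    with True km show ?thesis unfolding is_threshold_def sum by simp
  qed
  have iff: "is_minimizer x m M \<Phi> \<longleftrightarrow>
        (\<exists>k\<le>CARD('n). preserves_largest x \<alpha> k M \<Phi> \<and> perturbs_rest x m \<alpha> k M \<Phi> \<and>
                       k_smallest x m \<alpha> k)"
    if f: "feasible x m M \<Phi>" for M :: "'w measure" and \<Phi>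
  proof -
    let ?AE = "\<lambda>i. AE \<omega> in M. \<Phi> \<omega> $ \<alpha> i \<in> opt_vals \<tau> (x $ \<alpha> i)"
    have low: "?AE i \<longleftrightarrow> (AE \<omega> in M. \<Phi> \<omega> $ \<alpha> i = x $ \<alpha> i)" if "i \<in> {1..k}" for i
      using gt[of i] that kn by (simp add: opt_vals_def)
    have high: "?AE i \<longleftrightarrow> (let p = keep_prob x m \<alpha> k i in
        if x $ \<alpha> i = 0 then AE \<omega> in M. \<Phi> \<omega> $ \<alpha> i = 0
        else measure M {\<omega> \<in> space M. \<Phi> \<omega> $ \<alpha> i = x $ \<alpha> i / p} = p \<and>
             (AE \<omega> in M. \<Phi> \<omega> $ \<alpha> i = x $ \<alpha> i / p \<or> \<Phi> \<omega> $ \<alpha> i = 0))"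
      if i: "i \<in> {k+1..CARD('n)}" for i
    proof -
      have nle: "\<not> \<bar>x $ \<alpha> i\<bar> > \<tau>" using gt[of i] i by simp
      show ?thesis
      proof (cases "x $ \<alpha> i = 0")
        case True
        with nle show ?thesis by (simp add: opt_vals_def)
      next
        case False
        with nle have "0 < \<tau>" by linarith
        have v: "x $ \<alpha> i / (\<bar>x $ \<alpha> i\<bar> / \<tau>) = \<tau> * sgn (x $ \<alpha> i)"
          using False by (simp add: sgn_if)
        have AE: "?AE i \<longleftrightarrow> (AE \<omega> in M. \<Phi> \<omega> $ \<alpha> i = \<tau> * sgn (x $ \<alpha> i) \<or> \<Phi> \<omega> $ \<alpha> i = 0)"
          using nle by (simp add: opt_vals_def disj_commute)
        \<comment> \<open>The support condition already implies the probability clause, through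
          \<open>E \<Phi> = x\<close>.\<close>
        show ?thesis
          using feasible_prob_opt_val[OF f \<open>0 < \<tau>\<close> False] False
          unfolding Let_def keep v AE by auto
      qed
    qed
    have "is_minimizer x m M \<Phi> \<longleftrightarrow> (\<forall>i\<in>\<alpha> ` {1..CARD('n)}. AE \<omega> in M. \<Phi> \<omega> $ i \<in> opt_vals \<tau> (x $ i))"
      unfolding is_minimizer_iff_opt_vals[OF t f] bij_betw_imp_surj_on[OF assms(2)] by simp
    also have "\<dots> \<longleftrightarrow> (\<forall>i\<in>{1..k}. ?AE i) \<and> (\<forall>i\<in>{k+1..CARD('n)}. ?AE i)"
      unfolding split image_Un ball_Un by blast
    also have "(\<forall>i\<in>{1..k}. ?AE i) \<longleftrightarrow> preserves_largest x \<alpha> k M \<Phi>"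
      unfolding preserves_largest_def by (rule ball_cong[OF refl low])
    also have "(\<forall>i\<in>{k+1..CARD('n)}. ?AE i) \<longleftrightarrow> perturbs_rest x m \<alpha> k M \<Phi>"
      unfolding perturbs_rest_def by (rule ball_cong[OF refl high])
    finally show ?thesis using k kn k_unique by blast
  qed
  obtain N :: "(real ^ 'n) measure" and \<Psi>
    where "feasible x m N \<Psi>" "objective x N \<Psi> = ennreal (opt_value \<tau> x)"
    using exists_optimal[OF t] .
  then have "is_minimizer x m N \<Psi>"
    unfolding is_minimizer_def by (simp add: objective_ge[OF _ t])
  with iff show ?thesis by blast
qed

end
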